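(* Let $X=CI(d_1,\ldots,d_n)\subseteq\mathbb{P}^n$ be a complete intersection of points with $d_1\leq\cdots\leq d_n$, and suppose that $X$ splits as $X=CI(d_1,\ldots,d_{n-1},d_n-1)\cup CI(d_1,\ldots,d_{n-1},1)$. Let $m\geq 1$, $Z=\{X;m\}$ and $Y=\{X;m\}\setminus\{(P,m)\}$ for any $P\in CI(d_1,\ldots,d_{n-1},1)\subseteq X$ (the second complete intersection of the splitting). \begin{enumerate} \item[(i)] If $d_1=d_n$, then $m(d_1-1)\leq\alpha(Y)\leq\alpha(Z)=md_1$. \item[(ii)] If $d_1<d_n$, then $\alpha(Y)=\alpha(Z)=md_1$. \end{enumerate}
   Context: $k$ is an algebraically closed field of characteristic $0$, $R=k[x_0,\ldots,x_n]$ has the standard grading, and $\mathbb{P}^n=\mathbb{P}^n_k$. A complete intersection of points of type $(e_1,\ldots,e_n)$ (in any order), denoted $CI(e_1,\ldots,e_n)\subseteq\mathbb{P}^n$, is a set of $\prod_{i=1}^n e_i$ reduced points whose defining ideal is $(F_1,\ldots,F_n)$, where $F_1,\ldots,F_n$ is a regular sequence of homogeneous forms with $\deg F_i=e_i$, this ideal being radical. That $X=CI(d_1,\ldots,d_n)$ splits as $X=CI(d_1,\ldots,d_{i-1},d_i-1,d_{i+1},\ldots,d_n)\cup CI(d_1,\ldots,d_{i-1},1,d_{i+1},\ldots,d_n)$ (where $d_i\geq 2$) means that $X$ is the disjoint union of two complete intersections of points of the indicated types. For a finite set of points $X$ and $m\geq 1$, $\{X;m\}$ denotes the fat point scheme defined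 by $\bigcap_{Q\in X}\wp_Q^m$, where $\wp_Q\subseteq R$ is the defining ideal of the point $Q$; for $P\in X$, $\{X;m\}\setminus\{(P,m)\}$ is the fat point scheme defined by $\bigcap_{Q\in X\setminus\{P\}}\wp_Q^m$. For a fat point scheme $W$ with defining ideal $I_W$, $\alpha(W):=\min\{i\mid (I_W)_i\neq 0\}$. *)

theory Defs
  imports "HOL-Analysis.Analysis" "HOL-Library.Poly_Mapping"
    "HOL-Computational_Algebra.Polynomial"
begin

text \<open>
  The polynomial ring \<open>k[x\<^sub>0,\<dots>,x\<^sub>n]\<close> is rendered with a finite type \<open>'v\<close> of variables,
  where \<open>CARD('v) = n + 1\<close>: a monomial is its exponent map \<open>'v \<Rightarrow>\<^sub>0 nat\<close>, and a polynomial
  maps monomials to coefficients, with the convolution product of \<open>Poly_Mapping\<close>.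
\<close>

type_synonym ('a, 'v) polyring = "('v \<Rightarrow>\<^sub>0 nat) \<Rightarrow>\<^sub>0 'a"

text \<open>
  Ideals of a commutative ring are its submodules: \<open>ideal.span S\<close> is the ideal generated
  by \<open>S\<close>.
\<close>

global_interpretation ideal: module "(*) :: 'a \<Rightarrow> 'a \<Rightarrow> 'a::comm_ring_1"
  by standard (simp_all add: algebra_simps)

primrec ideal_power :: "'a::comm_ring_1 set \<Rightarrow> nat \<Rightarrow> 'a set" where
  "ideal_power I 0 = UNIV"
| "ideal_power I (Suc m) = ideal.span {f * g | f g. f \<in> I \<and> g \<in> ideal_power I m}"

definition is_radical :: "'a::comm_ring_1 set \<Rightarrow> bool" where
  "is_radical I \<longleftrightarrow> (\<forall>f k. f ^ k \<in> I \<longrightarrow> f \<in> I)"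

text \<open>Sequences \<open>F 1, \<dots>, F n\<close> are functions whose values outside \<open>{1..n}\<close> play no role.\<close>

definition regular_sequence :: "nat \<Rightarrow> (nat \<Rightarrow> 'a::comm_ring_1) \<Rightarrow> bool" where
  "regular_sequence n F \<longleftrightarrow>
     (\<forall>i\<in>{1..n}. \<forall>g. F i * g \<in> ideal.span (F ` {1..<i}) \<longrightarrow> g \<in> ideal.span (F ` {1..<i})) \<and>
     ideal.span (F ` {1..n}) \<noteq> UNIV"

definition monom_degree :: "('v::finite \<Rightarrow>\<^sub>0 nat) \<Rightarrow> nat" where
  "monom_degree u = (\<Sum>i\<in>UNIV. Poly_Mapping.lookup u i)"

text \<open>The graded piece \<open>R\<^sub>d\<close>, which contains \<open>0\<close>.\<close>

definition forms :: "nat \<Rightarrow> ('a::field, 'v::finite) polyring set" where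
  "forms d = {f. \<forall>u\<in>Poly_Mapping.keys f. monom_degree u = d}"

definition eval_poly :: "('a::field, 'v::finite) polyring \<Rightarrow> 'a ^ 'v \<Rightarrow> 'a" where
  "eval_poly f x = (\<Sum>u\<in>Poly_Mapping.keys f. Poly_Mapping.lookup f u * (\<Prod>i\<in>UNIV. x $ i ^ Poly_Mapping.lookup u i))"

text \<open>Points of projective space are the lines through the origin of \<open>'a ^ 'v\<close>.\<close>

definition proj_space :: "('a::field ^ 'v::finite) set set" where
  "proj_space = {vec.span {x} | x. x \<noteq> 0}"

text \<open>
  A form vanishes at a projective point iff it vanishes at all representatives; the zero vector
  of the line is not one of them.
\<close>

definition vanishing_ideal ::
    "('a::field ^ 'v::finite) set set \<Rightarrow> ('a, 'v) polyring set" where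
  "vanishing_ideal X =
     ideal.span {f. (\<exists>d. f \<in> forms d) \<and> (\<forall>Q\<in>X. \<forall>x\<in>Q - {0}. eval_poly f x = 0)}"

text \<open>
  \<open>complete_intersection n e X\<close>: the set \<open>X\<close> is a \<open>CI(e\<^sub>1,\<dots>,e\<^sub>n)\<close> in projective \<open>n\<close>-space.
  No order on the \<open>e\<^sub>i\<close> is imposed.
\<close>

definition complete_intersection ::
    "nat \<Rightarrow> (nat \<Rightarrow> nat) \<Rightarrow> ('a::field ^ 'v::finite) set set \<Rightarrow> bool" where
  "complete_intersection n e X \<longleftrightarrow>
     CARD('v) = n + 1 \<and> X \<subseteq> proj_space \<and> finite X \<and> card X = (\<Prod>i\<in>{1..n}. e i) \<and>
     (\<exists>F :: nat \<Rightarrow> ('a, 'v) polyring.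
        (\<forall>i\<in>{1..n}. F i \<in> forms (e i) \<and> F i \<noteq> 0) \<and>
        regular_sequence n F \<and>
        vanishing_ideal X = ideal.span (F ` {1..n}) \<and>
        is_radical (ideal.span (F ` {1..n})))"

text \<open>
  \<open>CI_splits n d i X X1 X2\<close>: the set \<open>X\<close>, a \<open>CI(d\<^sub>1,\<dots>,d\<^sub>n)\<close>, is the disjoint union of \<open>X1\<close> and
  \<open>X2\<close>, whose types are obtained from \<open>d\<close> by replacing \<open>d\<^sub>i\<close> by \<open>d\<^sub>i - 1\<close> and by \<open>1\<close>.
\<close>

definition CI_splits ::
    "nat \<Rightarrow> (nat \<Rightarrow> nat) \<Rightarrow> nat \<Rightarrow> ('a::field ^ 'v::finite) set set \<Rightarrow>
     ('a ^ 'v) set set \<Rightarrow> ('a ^ 'v) set set \<Rightarrow> bool" where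
  "CI_splits n d i X X1 X2 \<longleftrightarrow>
     i \<in> {1..n} \<and> d i \<ge> 2 \<and> complete_intersection n d X \<and>
     complete_intersection n (d(i := d i - 1)) X1 \<and>
     complete_intersection n (d(i := 1)) X2 \<and>
     X = X1 \<union> X2 \<and> X1 \<inter> X2 = {}"

text \<open>
  A fat point scheme is represented by its defining ideal; \<open>fat_ideal X m\<close> is that of \<open>{X;m}\<close>.
\<close>

definition fat_ideal ::
    "('a::field ^ 'v::finite) set set \<Rightarrow> nat \<Rightarrow> ('a, 'v) polyring set" where
  "fat_ideal X m = (\<Inter>Q\<in>X. ideal_power (vanishing_ideal {Q}) m)"

definition alpha :: "('a::field, 'v::finite) polyring set \<Rightarrow> nat" where
  "alpha I = (LEAST i. I \<inter> forms i \<noteq> {0})"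

end

theory Submission
  imports Defs
begin

text \<open>
  The theorem reduces to the equality of symbolic and ordinary powers of the ideal
  \<open>I = (F\<^sub>1,\<dots>,F\<^sub>n)\<close> of a complete intersection of points, because all elements of \<open>I\<^sup>m\<close> live
  in degrees \<open>\<ge> m * min e\<^sub>i\<close>, while \<open>F\<^sub>i\<^sup>m\<close> lies in the ideal of the fat points. For the equality,
  let \<open>f = \<Sum> g\<^sub>\<beta> F\<^sup>\<beta>\<close> with \<open>\<bar>\<beta>\<bar> = m\<close> vanish to order \<open>m + 1\<close> at every point. Restricting \<open>f\<close>
  to the lines \<open>s \<mapsto> q + s y\<close> through a representative \<open>q\<close> of a point and comparing
  coefficients of \<open>s\<^sup>m\<close> gives \<open>\<Sum> g\<^sub>\<beta>(q) \<Prod> (dF\<^sub>i(q) y)\<^sup>\<beta>\<^sup>i = 0\<close> for all \<open>y\<close>. The differentials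
  \<open>dF\<^sub>i(q)\<close> are linearly independent, since \<open>I\<close> contains forms whose differentials at \<open>q\<close> are all
  the linear forms vanishing at \<open>q\<close>. So all \<open>g\<^sub>\<beta>\<close> vanish on the points, that is, they lie in \<open>I\<close>.
  For \<open>Y\<close>, note \<open>X1 \<subseteq> X - {P} \<subseteq> X\<close>.
\<close>

text \<open>As a rewrite rule, this fact reassociates products to the left and loops with \<open>mult_ac\<close>.\<close>

declare ideal.scale_scale [simp del]

section \<open>Restriction of polynomials to lines\<close>

text \<open>The restriction s \<mapsto> f(q + s y), kept as a formal polynomial in s: the power of
  \<open>[:0, 1:]\<close> dividing it measures the order of vanishing at q in direction y, and its
  coefficient of s is the differential of f at q applied to y.\<close>

definition line_poly :: "('a::field, 'v::finite) polyring \<Rightarrow> 'a ^ 'v \<Rightarrow> 'a ^ 'v \<Rightarrow> 'a poly" where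
  "line_poly f q y = (\<Sum>u\<in>Poly_Mapping.keys f.
     smult (Poly_Mapping.lookup f u) (\<Prod>i\<in>UNIV. [:q $ i, y $ i:] ^ Poly_Mapping.lookup u i))"

text \<open>An index set larger than the support lets the sums for different polynomials run over
  the same monomials.\<close>

lemma line_poly_eq_sum:
  assumes "finite S" "Poly_Mapping.keys f \<subseteq> S"
  shows "line_poly f q y = (\<Sum>u\<in>S.
     smult (Poly_Mapping.lookup f u) (\<Prod>i\<in>UNIV. [:q $ i, y $ i:] ^ Poly_Mapping.lookup u i))"
  unfolding line_poly_def
  by (rule sum.mono_neutral_left) (use assms in \<open>auto simp: in_keys_iff\<close>)

lemma poly_line_poly: "poly (line_poly f q y) s = eval_poly f (q + s *s y)"
  by (simp add: line_poly_def eval_poly_def poly_sum poly_prod algebra_simps)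

lemma coeff_line_poly_0: "coeff (line_poly f q y) 0 = eval_poly f q"
  using poly_line_poly[of f q y 0] by (simp add: poly_0_coeff_0)

lemma line_poly_0 [simp]: "line_poly 0 q y = 0"
  by (simp add: line_poly_def)

lemma line_poly_single:
  "line_poly (Poly_Mapping.single u c) q y
     = smult c (\<Prod>i\<in>UNIV. [:q $ i, y $ i:] ^ Poly_Mapping.lookup u i)"
  by (subst line_poly_eq_sum[of "{u}"]) (auto simp: lookup_single)

lemma line_poly_1 [simp]: "line_poly 1 q y = 1"
  using line_poly_single[of 0 1 q y] by simp

lemma line_poly_add: "line_poly (f + g) q y = line_poly f q y + line_poly g q y"
proof -
  let ?S = "Poly_Mapping.keys f \<union> Poly_Mapping.keys g"
  have "Poly_Mapping.keys (f + g) \<subseteq> ?S" by (rule Poly_Mapping.keys_add)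
  then show ?thesis
    by (subst (1 2 3) line_poly_eq_sum[of ?S])
      (auto simp: lookup_add smult_add_left sum.distrib)
qed

lemma line_poly_sum: "line_poly (\<Sum>i\<in>A. f i) q y = (\<Sum>i\<in>A. line_poly (f i) q y)"
  by (induction A rule: infinite_finite_induct) (auto simp: line_poly_add)

lemma poly_mapping_eq_sum_single:
  "f = (\<Sum>u\<in>Poly_Mapping.keys f. Poly_Mapping.single u (Poly_Mapping.lookup f u))"
  by (rule poly_mapping_eqI) (auto simp: lookup_sum lookup_single when_def in_keys_iff)

lemma line_poly_single_mult_single:
  "line_poly (Poly_Mapping.single u a * Poly_Mapping.single v b) q y
     = line_poly (Poly_Mapping.single u a) q y * line_poly (Poly_Mapping.single v b) q y"
  by (simp add: mult_single line_poly_single lookup_add power_add prod.distrib mult_ac)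

lemma line_poly_mult: "line_poly (f * g) q y = line_poly f q y * line_poly g q y"
proof -
  \<comment> \<open>Multiplicativity is proved for the expansions into monomials, where bilinearity
    reduces it to two single monomials, and is then folded back.\<close>
  let ?s = "\<lambda>f. \<Sum>u\<in>Poly_Mapping.keys f. Poly_Mapping.single u (Poly_Mapping.lookup f u)"
  have "line_poly (?s f * ?s g) q y = line_poly (?s f) q y * line_poly (?s g) q y"
    by (simp only: sum_product line_poly_sum line_poly_single_mult_single)
  then show ?thesis by (simp only: flip: poly_mapping_eq_sum_single)
qed

lemma line_poly_power: "line_poly (f ^ k) q y = line_poly f q y ^ k"
  by (induction k) (auto simp: line_poly_mult)

lemma line_poly_prod: "line_poly (\<Prod>i\<in>A. f i) q y = (\<Prod>i\<in>A. line_poly (f i) q y)"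
  by (induction A rule: infinite_finite_induct) (auto simp: line_poly_mult)

text \<open>Evaluation is the constant coefficient of \<open>line_poly\<close> in any direction,
  here 0, and so inherits the ring homomorphism laws.\<close>

lemma eval_poly_0 [simp]: "eval_poly 0 x = 0"
  by (simp flip: coeff_line_poly_0[where y = 0])

lemma eval_poly_1 [simp]: "eval_poly 1 x = 1"
  by (simp flip: coeff_line_poly_0[where y = 0])

lemma eval_poly_add: "eval_poly (f + g) x = eval_poly f x + eval_poly g x"
  by (simp add: line_poly_add flip: coeff_line_poly_0[where y = 0])

lemma eval_poly_mult: "eval_poly (f * g) x = eval_poly f x * eval_poly g x"
  by (simp add: line_poly_mult coeff_mult_0 flip: coeff_line_poly_0[where y = 0])

lemma eval_poly_power: "eval_poly (f ^ k) x = eval_poly f x ^ k"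
  by (induction k) (auto simp: eval_poly_mult)

lemma eval_poly_sum: "eval_poly (\<Sum>i\<in>A. f i) x = (\<Sum>i\<in>A. eval_poly (f i) x)"
  by (induction A rule: infinite_finite_induct) (auto simp: eval_poly_add)

lemma eval_poly_prod: "eval_poly (\<Prod>i\<in>A. f i) x = (\<Prod>i\<in>A. eval_poly (f i) x)"
  by (induction A rule: infinite_finite_induct) (auto simp: eval_poly_mult)

lemma eval_poly_forms_scale:
  assumes "f \<in> forms k"
  shows "eval_poly f (t *s x) = t ^ k * eval_poly f x"
  unfolding eval_poly_def sum_distrib_left
proof (rule sum.cong[OF refl])
  fix u
  assume "u \<in> Poly_Mapping.keys f"
  then have k: "(\<Sum>i\<in>UNIV. Poly_Mapping.lookup u i) = k"
    using assms by (simp add: forms_def monom_degree_def)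
  have "(\<Prod>i\<in>UNIV. (t *s x) $ i ^ Poly_Mapping.lookup u i)
      = t ^ k * (\<Prod>i\<in>UNIV. x $ i ^ Poly_Mapping.lookup u i)"
    by (simp add: power_mult_distrib prod.distrib k flip: power_sum)
  then show "Poly_Mapping.lookup f u * (\<Prod>i\<in>UNIV. (t *s x) $ i ^ Poly_Mapping.lookup u i)
      = t ^ k * (Poly_Mapping.lookup f u * (\<Prod>i\<in>UNIV. x $ i ^ Poly_Mapping.lookup u i))"
    by (simp only: mult.left_commute)
qed

text \<open>The Leibniz rule, once p and r are restrictions to a line.\<close>

lemma coeff_mult_1: "coeff (p * r) 1 = coeff p 0 * coeff r 1 + coeff p 1 * coeff r 0"
  by (simp add: coeff_mult atMost_Suc add.commute)

lemma linear_dvd_iff: "[:0, 1:] dvd p \<longleftrightarrow> poly p 0 = (0::'a::comm_ring_1)"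
  using poly_eq_0_iff_dvd[of p 0] by simp

text \<open>The coordinates of q + s y have this property and ring operations preserve it. It makes
  the differentials at q into a linear map of y in \<open>differentials_surj\<close>.\<close>

lemma coeff_line_poly_1_linear:
  fixes f :: "('a::field, 'v::finite) polyring"
  shows "\<exists>l. \<forall>y. coeff (line_poly f q y) 1 = (\<Sum>i\<in>UNIV. l i * y $ i)"
proof -
  \<comment> \<open>The constant coefficient must be independent of y, because by the Leibniz rule
    it multiplies the linear part of the other factor.\<close>
  define L :: "('a ^ 'v \<Rightarrow> 'a poly) \<Rightarrow> bool" where
    "L p \<longleftrightarrow> (\<exists>c l. \<forall>y. coeff (p y) 0 = c \<and> coeff (p y) 1 = (\<Sum>i\<in>UNIV. l i * y $ i))" for p
  have LI: "L p" if "\<And>y. coeff (p y) 0 = c" "\<And>y. coeff (p y) 1 = (\<Sum>i\<in>UNIV. l i * y $ i)" for p c l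
    unfolding L_def by (rule exI[of _ c], rule exI[of _ l]) (use that in simp)
  have Lconst: "L (\<lambda>y. [:c:])" for c
    by (rule LI[of _ c "\<lambda>_. 0"]) simp_all
  have L1: "L (\<lambda>y. 1)"
    using Lconst[of 1] by (simp add: one_pCons)
  have Lmult: "L (\<lambda>y. p y * r y)" if "L p" "L r" for p r
  proof -
    from that(1) obtain c l where
      p: "\<forall>y. coeff (p y) 0 = c \<and> coeff (p y) 1 = (\<Sum>i\<in>UNIV. l i * y $ i)"
      unfolding L_def by (elim exE) rule
    from that(2) obtain c' l' where
      r: "\<forall>y. coeff (r y) 0 = c' \<and> coeff (r y) 1 = (\<Sum>i\<in>UNIV. l' i * y $ i)"
      unfolding L_def by (elim exE) rule
    show ?thesis
    proof (rule LI)
      show "coeff (p y * r y) 0 = c * c'" for y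
        using p r by (simp add: coeff_mult_0)
      show "coeff (p y * r y) 1 = (\<Sum>i\<in>UNIV. (c * l' i + l i * c') * y $ i)" for y
      proof -
        have "coeff (p y * r y) 1 = c * (\<Sum>i\<in>UNIV. l' i * y $ i) + (\<Sum>i\<in>UNIV. l i * y $ i) * c'"
          using p r by (simp only: coeff_mult_1)
        also have "\<dots> = (\<Sum>i\<in>UNIV. c * (l' i * y $ i) + l i * y $ i * c')"
          by (simp only: sum_distrib_left sum_distrib_right sum.distrib)
        also have "\<dots> = (\<Sum>i\<in>UNIV. (c * l' i + l i * c') * y $ i)"
          by (rule sum.cong) (simp_all add: algebra_simps)
        finally show ?thesis .
      qed
    qed
  qed
  have Ladd: "L (\<lambda>y. p y + r y)" if "L p" "L r" for p r
  proof -
    from that(1) obtain c l where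
      p: "\<forall>y. coeff (p y) 0 = c \<and> coeff (p y) 1 = (\<Sum>i\<in>UNIV. l i * y $ i)"
      unfolding L_def by (elim exE) rule
    from that(2) obtain c' l' where
      r: "\<forall>y. coeff (r y) 0 = c' \<and> coeff (r y) 1 = (\<Sum>i\<in>UNIV. l' i * y $ i)"
      unfolding L_def by (elim exE) rule
    show ?thesis
    proof (rule LI)
      show "coeff (p y + r y) 0 = c + c'" for y
        using p r by simp
      show "coeff (p y + r y) 1 = (\<Sum>i\<in>UNIV. (l i + l' i) * y $ i)" for y
        using p r by (simp only: coeff_add sum.distrib distrib_right)
    qed
  qed
  have Lvar: "L (\<lambda>y. [:q $ j, y $ j:])" for j
    by (rule LI[of _ "q $ j" "\<lambda>i. if i = j then 1 else 0"])
      (simp_all add: if_distrib[of "\<lambda>a. a * _"] cong: if_cong)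
  have Lpow: "L (\<lambda>y. p y ^ k)" if "L p" for p k
    using that by (induction k) (simp_all add: L1 Lmult)
  have Lprod: "L (\<lambda>y. \<Prod>i\<in>A. p i y)" if "\<And>i. L (p i)" for p :: "'v \<Rightarrow> _" and A
    using that by (induction A rule: infinite_finite_induct) (simp_all add: L1 Lmult)
  have Lsmult: "L (\<lambda>y. smult c (p y))" if "L p" for p c
    using Lmult[OF Lconst[of c] that] by simp
  have Lsum: "L (\<lambda>y. \<Sum>i\<in>A. p i y)" if "\<And>i. L (p i)" for p :: "('v \<Rightarrow>\<^sub>0 nat) \<Rightarrow> _" and A
    using that Lconst[of 0] by (induction A rule: infinite_finite_induct) (simp_all add: Ladd)
  have "L (line_poly f q)"
    unfolding line_poly_def by (intro Lsum Lsmult Lprod Lpow Lvar)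
  then show ?thesis unfolding L_def by blast
qed

section \<open>Polynomials over an infinite field as functions\<close>

lemma poly_eq_0_if_infinite_zeros:
  fixes p :: "'a::idom poly"
  assumes "infinite A" "\<And>x. x \<in> A \<Longrightarrow> poly p x = 0"
  shows "p = 0"
proof (rule ccontr)
  assume "p \<noteq> 0"
  then have "finite {x. poly p x = 0}" by (rule poly_roots_finite)
  moreover have "A \<subseteq> {x. poly p x = 0}" using assms by auto
  ultimately show False using assms(1) finite_subset by blast
qed

text \<open>An arbitrary infinite \<open>A\<close> covers the nonzero scalars, the only ones that
  preserve representatives of a projective point.\<close>

lemma power_sum_coeff_eq_0:
  fixes c :: "nat \<Rightarrow> 'a::idom"
  assumes "infinite A" "finite K" "\<And>x. x \<in> A \<Longrightarrow> (\<Sum>k\<in>K. c k * x ^ k) = 0" "k \<in> K"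
  shows "c k = 0"
proof -
  let ?p = "\<Sum>k\<in>K. monom (c k) k"
  have "?p = 0"
    by (rule poly_eq_0_if_infinite_zeros[OF assms(1)]) (use assms(3) in \<open>simp add: poly_sum poly_monom\<close>)
  then have "coeff ?p k = 0" by simp
  moreover have "coeff ?p k = c k" using assms(2,4) by (simp add: coeff_sum)
  ultimately show ?thesis by simp
qed

text \<open>Induction on the variables: with the others fixed, the sum is a polynomial in one
  variable, and each of its coefficients is a sum of the same kind in fewer variables. The abstract
  index set \<open>B\<close> serves both the support of a polynomial and the multi-indices
  \<beta>.\<close>

lemma monomial_sum_coeff_eq_0:
  fixes c :: "'b \<Rightarrow> 'a::{idom, ring_char_0}" and e :: "'b \<Rightarrow> 'i \<Rightarrow> nat"
  assumes "finite S" "finite B" "inj_on (\<lambda>b. restrict (e b) S) B"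
    and "\<And>z. (\<Sum>b\<in>B. c b * (\<Prod>i\<in>S. z i ^ e b i)) = 0" and "b \<in> B"
  shows "c b = 0"
  using assms
proof (induction S arbitrary: B b rule: finite_induct)
  case empty
  then have "B = {b}" by (auto simp: inj_on_def)
  with empty show ?case by simp
next
  case (insert i S)
  \<comment> \<open>Indices sharing their exponent at i with b remain distinguishable after i is
    dropped.\<close>
  let ?B = "{b'\<in>B. e b' i = e b i}"
  show ?case
  proof (rule insert.IH[of ?B])
    show "inj_on (\<lambda>b. restrict (e b) S) ?B"
    proof (rule inj_onI)
      fix x y
      assume x: "x \<in> ?B" and y: "y \<in> ?B" and eq: "restrict (e x) S = restrict (e y) S"
      have "restrict (e x) (insert i S) = restrict (e y) (insert i S)"
      proof
        fix k
        show "restrict (e x) (insert i S) k = restrict (e y) (insert i S) k"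
          using x y fun_cong[OF eq, of k] by (cases "k \<in> S") (auto simp: restrict_def)
      qed
      then show "x = y" using x y by (intro inj_onD[OF insert.prems(2)]) auto
    qed
    fix z :: "'i \<Rightarrow> 'a"
    let ?K = "(\<lambda>b. e b i) ` B"
    \<comment> \<open>The coefficient of t^k after t is substituted for the variable i.\<close>
    let ?c = "\<lambda>k. \<Sum>b\<in>{b'\<in>B. e b' i = k}. c b * (\<Prod>j\<in>S. z j ^ e b j)"
    have "(\<Sum>k\<in>?K. ?c k * t ^ k) = 0" for t
    proof -
      have "0 = (\<Sum>b\<in>B. c b * (\<Prod>j\<in>insert i S. (z(i := t)) j ^ e b j))"
        using insert.prems(3) by simp
      also have "\<dots> = (\<Sum>b\<in>B. c b * (\<Prod>j\<in>S. z j ^ e b j) * t ^ e b i)"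
      proof (rule sum.cong[OF refl])
        fix b
        have "(\<Prod>j\<in>S. (z(i := t)) j ^ e b j) = (\<Prod>j\<in>S. z j ^ e b j)"
          using insert.hyps by (intro prod.cong) auto
        then show "c b * (\<Prod>j\<in>insert i S. (z(i := t)) j ^ e b j)
            = c b * (\<Prod>j\<in>S. z j ^ e b j) * t ^ e b i"
          using insert.hyps by (simp add: mult_ac)
      qed
      also have "\<dots> = (\<Sum>k\<in>?K. \<Sum>b\<in>{b'\<in>B. e b' i = k}. c b * (\<Prod>j\<in>S. z j ^ e b j) * t ^ e b i)"
        using insert.prems(1) by (rule sum.image_gen)
      also have "\<dots> = (\<Sum>k\<in>?K. ?c k * t ^ k)"
        by (simp add: sum_distrib_right)
      finally show ?thesis by simp
    qed
    then show "?c (e b i) = 0"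
      using insert.prems(1,4)
      by (intro power_sum_coeff_eq_0[OF infinite_UNIV_char_0, of ?K ?c]) auto
  qed (use insert.prems in auto)
qed

lemma poly_eq_0_if_eval_poly_eq_0:
  fixes f :: "('a::field_char_0, 'v::finite) polyring"
  assumes "\<And>x. eval_poly f x = 0"
  shows "f = 0"
proof (rule poly_mapping_eqI)
  fix u
  show "Poly_Mapping.lookup f u = Poly_Mapping.lookup 0 u"
  proof (cases "u \<in> Poly_Mapping.keys f")
    case True
    have "Poly_Mapping.lookup f u = 0"
    proof (rule monomial_sum_coeff_eq_0[where S = UNIV and B = "Poly_Mapping.keys f" and e = Poly_Mapping.lookup])
      show "inj_on (\<lambda>b. restrict (Poly_Mapping.lookup b) UNIV) (Poly_Mapping.keys f)"
        by (rule inj_onI) (auto simp: restrict_def fun_eq_iff intro: poly_mapping_eqI)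
      show "(\<Sum>b\<in>Poly_Mapping.keys f. Poly_Mapping.lookup f b * (\<Prod>i\<in>UNIV. z i ^ Poly_Mapping.lookup b i)) = 0"
        for z :: "'v \<Rightarrow> 'a"
        using assms[of "\<chi> i. z i"] by (simp add: eval_poly_def)
    qed (use True in auto)
    then show ?thesis by simp
  qed (simp add: in_keys_iff)
qed

section \<open>Forms and vanishing ideals\<close>

lemma forms_0 [simp]: "0 \<in> forms k"
  by (simp add: forms_def)

lemma forms_1: "1 \<in> forms 0"
  by (simp add: forms_def monom_degree_def)

lemma monom_degree_add: "monom_degree (u + v) = monom_degree u + monom_degree v"
  by (simp add: monom_degree_def lookup_add sum.distrib)

lemma forms_mult: "f \<in> forms k \<Longrightarrow> g \<in> forms l \<Longrightarrow> f * g \<in> forms (k + l)"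
  unfolding forms_def using keys_mult[of f g] by (fastforce simp: monom_degree_add)

lemma forms_power: "f \<in> forms k \<Longrightarrow> f ^ m \<in> forms (m * k)"
  by (induction m) (auto simp: forms_1 forms_mult)

lemma forms_prod: "(\<And>i. i \<in> A \<Longrightarrow> f i \<in> forms (k i)) \<Longrightarrow> (\<Prod>i\<in>A. f i) \<in> forms (\<Sum>i\<in>A. k i)"
  by (induction A rule: infinite_finite_induct) (auto simp: forms_1 forms_mult)

text \<open>This ideal is the N-th power of the ideal generated by the variables. A degree bound on
  generators passes through it to everything they generate.\<close>

lemma subspace_low_degree_zero:
  "ideal.subspace {f :: ('a::field, 'v::finite) polyring. \<forall>u\<in>Poly_Mapping.keys f. N \<le> monom_degree u}"
proof (rule ideal.subspaceI)
  fix f g :: "('a, 'v) polyring"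
  assume "g \<in> {f. \<forall>u\<in>Poly_Mapping.keys f. N \<le> monom_degree u}"
  then show "f * g \<in> {f. \<forall>u\<in>Poly_Mapping.keys f. N \<le> monom_degree u}"
    using keys_mult[of f g] by (fastforce simp: monom_degree_add)
qed (use Poly_Mapping.keys_add in fastforce)+

lemma vanishing_ideal_formI:
  "f \<in> forms k \<Longrightarrow> (\<And>Q x. Q \<in> X \<Longrightarrow> x \<in> Q \<Longrightarrow> x \<noteq> 0 \<Longrightarrow> eval_poly f x = 0) \<Longrightarrow> f \<in> vanishing_ideal X"
  unfolding vanishing_ideal_def by (rule ideal.span_base) blast

lemma subspace_vanishing_ideal: "ideal.subspace (vanishing_ideal X)"
  unfolding vanishing_ideal_def by (rule ideal.subspace_span)

lemma eval_poly_vanishing_ideal: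
  assumes "f \<in> vanishing_ideal X" "Q \<in> X" "x \<in> Q" "x \<noteq> 0"
  shows "eval_poly f x = 0"
  using assms(1) unfolding vanishing_ideal_def
proof (induction rule: ideal.span_induct_alt)
  case (step c g h)
  then show ?case using assms(2-4) by (auto simp: eval_poly_add eval_poly_mult)
qed simp

lemma vanishing_ideal_antimono: "A \<subseteq> B \<Longrightarrow> vanishing_ideal B \<subseteq> vanishing_ideal A"
  unfolding vanishing_ideal_def by (rule ideal.span_mono) blast

text \<open>The homogeneous components of f vanish separately: f(t x) is a polynomial in t whose
  coefficients are their values at x, and it is zero for all nonzero t. This is applied to the
  coefficients g_\<beta>, which are not known to be homogeneous.\<close>

lemma vanishing_idealI:
  fixes f :: "('a::field_char_0, 'v::finite) polyring"
  assumes X: "X \<subseteq> proj_space"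
    and f: "\<And>Q x. Q \<in> X \<Longrightarrow> x \<in> Q \<Longrightarrow> x \<noteq> 0 \<Longrightarrow> eval_poly f x = 0"
  shows "f \<in> vanishing_ideal X"
proof -
  let ?c = "\<lambda>k. \<Sum>u\<in>{u\<in>Poly_Mapping.keys f. monom_degree u = k}.
    Poly_Mapping.single u (Poly_Mapping.lookup f u)"
  let ?K = "monom_degree ` Poly_Mapping.keys f"
  have decomp: "f = (\<Sum>k\<in>?K. ?c k)"
    using poly_mapping_eq_sum_single by (rule trans) (rule sum.image_gen[OF finite_keys])
  have form: "?c k \<in> forms k" for k
    unfolding forms_def mem_Collect_eq
    by (intro ballI, drule subsetD[OF Poly_Mapping.keys_sum]) (auto split: if_splits)
  have "?c k \<in> vanishing_ideal X" if k: "k \<in> ?K" for k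
  proof (rule vanishing_ideal_formI[OF form])
    fix Q x
    assume Q: "Q \<in> X" and x: "x \<in> Q" "x \<noteq> 0"
    have "(\<Sum>k\<in>?K. eval_poly (?c k) x * t ^ k) = 0" if "t \<in> - {0}" for t
    proof -
      have "t *s x \<in> Q" using Q X x by (auto simp: proj_space_def vec.span_scale)
      then have "0 = eval_poly f (t *s x)" using f[OF Q] x that by simp
      also have "\<dots> = eval_poly (\<Sum>k\<in>?K. ?c k) (t *s x)" using decomp by simp
      also have "\<dots> = (\<Sum>k\<in>?K. eval_poly (?c k) x * t ^ k)"
        by (subst eval_poly_sum) (simp add: eval_poly_forms_scale[OF form] mult.commute)
      finally show ?thesis by simp
    qed
    then show "eval_poly (?c k) x = 0"
      using k infinite_UNIV_char_0[where 'a = 'a]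
      by (intro power_sum_coeff_eq_0[of "- {0}" ?K "\<lambda>k. eval_poly (?c k) x"])
        (auto simp: Compl_eq_Diff_UNIV)
  qed
  then show ?thesis
    by (subst decomp) (rule ideal.subspace_sum[OF subspace_vanishing_ideal])
qed

text \<open>Each of the m factors from the ideal of the point vanishes at q and contributes one
  factor s.\<close>

lemma dvd_line_poly_ideal_power:
  assumes "q \<in> Q" "q \<noteq> 0" "f \<in> ideal_power (vanishing_ideal {Q}) m"
  shows "[:0, 1:] ^ m dvd line_poly f q y"
  using assms(3)
proof (induction m arbitrary: f)
  case (Suc m)
  then have "f \<in> ideal.span {f * g |f g. f \<in> vanishing_ideal {Q} \<and> g \<in> ideal_power (vanishing_ideal {Q}) m}"
    by simp
  then show ?case
  proof (induction rule: ideal.span_induct_alt)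
    case (step c g h)
    then obtain a b where g: "g = a * b" and a: "a \<in> vanishing_ideal {Q}"
      and b: "b \<in> ideal_power (vanishing_ideal {Q}) m" by blast
    have "poly (line_poly a q y) 0 = 0"
      using eval_poly_vanishing_ideal[OF a _ assms(1,2)] by (simp add: poly_line_poly)
    then have "[:0, 1:] dvd line_poly a q y" by (simp add: linear_dvd_iff)
    then have "[:0, 1:] ^ Suc m dvd line_poly g q y"
      using Suc.IH[OF b] by (simp only: g line_poly_mult power_Suc mult_dvd_mono)
    then show ?case using step.IH by (simp only: line_poly_add line_poly_mult dvd_add dvd_mult)
  qed simp
qed simp

lemma power_mem_ideal_power: "f \<in> I \<Longrightarrow> f ^ m \<in> ideal_power I m"
  by (induction m) (auto intro!: ideal.span_base)

lemma power_mem_fat_ideal: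
  assumes "f \<in> vanishing_ideal X"
  shows "f ^ m \<in> fat_ideal X m"
  unfolding fat_ideal_def
  using vanishing_ideal_antimono[of "{_}" X] assms by (auto intro!: power_mem_ideal_power)

section \<open>Independence of the differentials\<close>

text \<open>The 2x2 minor p_i x_j - p_j x_i of the matrix with rows p and x. For p nonzero these
  linear forms cut out the line spanned by p.\<close>

definition minor_form :: "'v \<Rightarrow> 'v \<Rightarrow> 'a ^ 'v \<Rightarrow> ('a::field, 'v::finite) polyring" where
  "minor_form i j p = Poly_Mapping.single (Poly_Mapping.single j 1) (p $ i)
     + Poly_Mapping.single (Poly_Mapping.single i 1) (- (p $ j))"

lemma line_poly_minor_form:
  "line_poly (minor_form i j p) q y = smult (p $ i) [:q $ j, y $ j:] - smult (p $ j) [:q $ i, y $ i:]"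
proof -
  have "(\<Prod>k\<in>UNIV. [:q $ k, y $ k:] ^ Poly_Mapping.lookup (Poly_Mapping.single l (1::nat)) k) = [:q $ l, y $ l:]" for l
    by (subst prod.remove[of UNIV l]) (auto simp: lookup_single)
  then show ?thesis by (simp add: minor_form_def line_poly_add line_poly_single)
qed

lemma eval_poly_minor_form: "eval_poly (minor_form i j p) x = p $ i * x $ j - p $ j * x $ i"
  using coeff_line_poly_0[of "minor_form i j p" x 0] by (simp add: line_poly_minor_form)

lemma minor_form_forms:
  fixes p :: "'a::field ^ 'v::finite"
  shows "minor_form i j p \<in> forms 1"
proof -
  have "monom_degree (Poly_Mapping.single l 1) = 1"  for l :: 'v
    by (simp add: monom_degree_def lookup_single when_def)
  then show ?thesis
    unfolding forms_def minor_form_def using Poly_Mapping.keys_add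
    by (fastforce split: if_splits)
qed

lemma proj_space_eq_span:
  assumes "Q \<in> proj_space" "q \<in> Q" "q \<noteq> 0"
  shows "Q = vec.span {q}"
proof -
  obtain x where x: "Q = vec.span {x}" "x \<noteq> 0" using assms(1) by (auto simp: proj_space_def)
  then obtain c where c: "q = c *s x" using assms(2) by (auto simp: vec.span_singleton)
  then have "c \<noteq> 0" using assms(3) by auto
  then have "x = inverse c *s q" using c by (simp add: vec.scale_scale)
  then have "x \<in> vec.span {q}" by (auto intro: vec.span_scale vec.span_base)
  moreover have "q \<in> vec.span {x}" unfolding c by (auto intro: vec.span_scale vec.span_base)
  ultimately show ?thesis unfolding x(1) vec.span_eq by blast
qed

text \<open>For each other point, spanned by p, some minor of p and q is nonzero, since otherwise
  the two points would coincide. H is the product of the corresponding linear forms.\<close>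

lemma separating_form:
  fixes X :: "('a::field ^ 'v::finite) set set"
  assumes X: "X \<subseteq> proj_space" "finite X" and Q: "Q \<in> X" and q: "q \<in> Q" "q \<noteq> 0"
  obtains H k where "H \<in> forms k" "eval_poly H q \<noteq> 0"
    "\<And>Q' x. Q' \<in> X - {Q} \<Longrightarrow> x \<in> Q' \<Longrightarrow> eval_poly H x = 0"
proof -
  have "\<exists>L\<in>forms 1. eval_poly L q \<noteq> 0 \<and> (\<forall>x\<in>Q'. eval_poly L x = 0)" if Q': "Q' \<in> X - {Q}" for Q'
  proof -
    obtain p where p: "Q' = vec.span {p}" "p \<noteq> 0" using X(1) Q' by (auto simp: proj_space_def)
    then obtain i where i: "p $ i \<noteq> 0" by (auto simp: vec_eq_iff)
    have "\<exists>j. p $ i * q $ j \<noteq> p $ j * q $ i"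
    proof (rule ccontr)
      assume "\<not> ?thesis"
      then have "q = (q $ i / p $ i) *s p" using i by (simp add: vec_eq_iff field_simps)
      then have "q \<in> Q'" using p(1) by (metis vec.span_base vec.span_scale singletonI)
      then have "Q' = vec.span {q}" using proj_space_eq_span X(1) Q' q(2) by blast
      moreover have "Q = vec.span {q}" using proj_space_eq_span X(1) Q q by blast
      ultimately show False using Q' by simp
    qed
    then obtain j where j: "p $ i * q $ j \<noteq> p $ j * q $ i" by blast
    have "\<forall>x\<in>Q'. eval_poly (minor_form i j p) x = 0"
      using p(1) by (auto simp: vec.span_singleton eval_poly_minor_form)
    then show ?thesis
      using j by (intro bexI[of _ "minor_form i j p"]) (auto simp: eval_poly_minor_form minor_form_forms simp del: One_nat_def)
  qed
  then obtain L where L: "\<And>Q'. Q' \<in> X - {Q} \<Longrightarrow> L Q' \<in> forms 1"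
    "\<And>Q'. Q' \<in> X - {Q} \<Longrightarrow> eval_poly (L Q') q \<noteq> 0"
    "\<And>Q' x. Q' \<in> X - {Q} \<Longrightarrow> x \<in> Q' \<Longrightarrow> eval_poly (L Q') x = 0" by metis
  show ?thesis
  proof (rule that)
    show "(\<Prod>Q'\<in>X - {Q}. L Q') \<in> forms (\<Sum>Q'\<in>X - {Q}. 1)" by (rule forms_prod) (rule L)
    show "eval_poly (\<Prod>Q'\<in>X - {Q}. L Q') q \<noteq> 0"
      using X(2) L(2) by (simp add: eval_poly_prod)
    show "eval_poly (\<Prod>Q'\<in>X - {Q}. L Q') x = 0" if "Q' \<in> X - {Q}" "x \<in> Q'" for Q' x
      unfolding eval_poly_prod using X(2) L(3)[OF that] that(1) by (intro prod_zero) auto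
  qed
qed

text \<open>By the Leibniz rule, every element of the ideal has derivative 0 at q in direction y. A
  minor form of q times a form H separating q from the other points lies in the ideal, and its
  derivative is the minor at y times H(q). It is essential that \<open>G\<close> generates the whole
  vanishing ideal, that is, that the points are reduced.\<close>

lemma differentials_zero_imp_parallel:
  fixes X :: "('a::field ^ 'v::finite) set set"
  assumes X: "X \<subseteq> proj_space" "finite X" and Q: "Q \<in> X" and q: "q \<in> Q" "q \<noteq> 0"
    and gen: "vanishing_ideal X = ideal.span G"
    and zero: "\<And>g. g \<in> G \<Longrightarrow> coeff (line_poly g q y) 1 = 0"
  shows "q $ i * y $ j = q $ j * y $ i"
proof -
  obtain H k where H: "H \<in> forms k" "eval_poly H q \<noteq> 0"
    "\<And>Q' x. Q' \<in> X - {Q} \<Longrightarrow> x \<in> Q' \<Longrightarrow> eval_poly H x = 0"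
    using separating_form[OF X Q q] by blast
  have Qq: "Q = vec.span {q}" using proj_space_eq_span X(1) Q q by blast
  have "minor_form i j q * H \<in> vanishing_ideal X"
  proof (rule vanishing_ideal_formI)
    show "minor_form i j q * H \<in> forms (1 + k)" by (intro forms_mult minor_form_forms H)
    fix Q' x
    assume "Q' \<in> X" "x \<in> Q'" "x \<noteq> 0"
    then show "eval_poly (minor_form i j q * H) x = 0"
      using H(3)[of Q' x] Qq
      by (cases "Q' = Q") (auto simp: eval_poly_mult eval_poly_minor_form vec.span_singleton)
  qed
  moreover have "coeff (line_poly f q y) 0 = 0 \<and> coeff (line_poly f q y) 1 = 0"
    if "f \<in> ideal.span G" for f
    using that
  proof (induction rule: ideal.span_induct_alt)
    case (step c g h)
    \<comment> \<open>As g(q) = 0, the Leibniz term containing the derivative of c drops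
      out.\<close>
    have "g \<in> vanishing_ideal X" unfolding gen by (rule ideal.span_base) (rule step)
    then have "coeff (line_poly g q y) 0 = 0"
      using eval_poly_vanishing_ideal Q q by (auto simp: coeff_line_poly_0)
    then show ?case using step zero[of g] by (simp add: line_poly_add line_poly_mult coeff_mult)
  qed simp
  ultimately have "coeff (line_poly (minor_form i j q * H) q y) 1 = 0" unfolding gen by blast
  then have "(q $ i * y $ j - q $ j * y $ i) * eval_poly H q = 0"
    by (simp add: line_poly_mult coeff_mult line_poly_minor_form coeff_line_poly_0)
  then show ?thesis using H(2) by simp
qed

text \<open>The n differentials live on a space of dimension n + 1 and their common kernel is
  contained in the line of q, so they are independent and jointly attain all values z.\<close>

lemma differentials_surj:
  fixes X :: "('a::field ^ 'v::finite) set set" and F :: "nat \<Rightarrow> ('a, 'v) polyring"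
  assumes X: "X \<subseteq> proj_space" "finite X" and Q: "Q \<in> X" and q: "q \<in> Q" "q \<noteq> 0"
    and card: "CARD('v) = n + 1"
    and gen: "vanishing_ideal X = ideal.span (F ` {1..n})"
  obtains y where "\<And>i. i \<in> {1..n} \<Longrightarrow> coeff (line_poly (F i) q y) 1 = z i"
proof -
  obtain i0 where i0: "q $ i0 \<noteq> 0" using q(2) by (auto simp: vec_eq_iff)
  have "card (UNIV - {i0}) = card {1..n}" using card by simp
  then obtain \<sigma> where \<sigma>: "bij_betw \<sigma> (UNIV - {i0}) {1..n}"
    using finite_same_card_bij[of "UNIV - {i0}" "{1..n}"] finite by blast
  have preimage: "\<exists>k. k \<noteq> i0 \<and> i = \<sigma> k" if "i \<in> {1..n}" for i
    using bij_betw_imp_surj_on[OF \<sigma>] that by blast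
  \<comment> \<open>The coordinate \<open>i0\<close>, nonzero at q, is joined to the n
    differentials, which \<sigma> distributes over the other coordinates. It removes the kernel
    direction q and yields an endomorphism, for which injectivity implies surjectivity.\<close>
  define T where "T y = (\<chi> j. if j = i0 then y $ i0 else coeff (line_poly (F (\<sigma> j)) q y) 1)" for y
  have lin: "Vector_Spaces.linear (*s) (*s) T"
  proof -
    have "\<forall>f :: ('a, 'v) polyring. \<exists>l. \<forall>y. coeff (line_poly f q y) 1 = (\<Sum>i\<in>UNIV. l i * y $ i)"
      by (rule allI) (rule coeff_line_poly_1_linear)
    from choice[OF this] obtain l where
      l: "\<forall>f y. coeff (line_poly f q y) 1 = (\<Sum>i\<in>UNIV. l f i * y $ i)" ..
    show ?thesis
      unfolding Vector_Spaces.linear_iff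
    proof (intro conjI allI)
      show "vector_space ((*s) :: 'a \<Rightarrow> 'a ^ 'v \<Rightarrow> _)" "vector_space ((*s) :: 'a \<Rightarrow> 'a ^ 'v \<Rightarrow> _)"
        by (rule vec.vector_space_axioms)+
      show "T (y + w) = T y + T w" for y w
        by (simp add: T_def l vec_eq_iff distrib_left sum.distrib del: One_nat_def)
      show "T (r *s y) = r *s T y" for r y
        by (simp add: T_def l vec_eq_iff sum_distrib_left mult.left_commute del: One_nat_def)
    qed
  qed
  have "inj T"
  proof (rule vec.linear_inj_iff_eq_0[OF lin, THEN iffD2], intro allI impI)
    fix y
    assume T: "T y = 0"
    have "y $ i0 = 0" using fun_cong[OF arg_cong[OF T, of vec_nth], of i0] by (simp add: T_def)
    moreover have "q $ i0 * y $ j = q $ j * y $ i0" for j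
    proof (rule differentials_zero_imp_parallel[OF X Q q gen])
      fix g
      assume "g \<in> F ` {1..n}"
      then obtain k where "k \<noteq> i0" "g = F (\<sigma> k)" using preimage by blast
      then show "coeff (line_poly g q y) 1 = 0"
        using fun_cong[OF arg_cong[OF T, of vec_nth], of k] by (simp add: T_def)
    qed
    ultimately show "y = 0" using i0 by (simp add: vec_eq_iff)
  qed
  then have "surj T" by (rule vec.linear_injective_imp_surjective[OF lin _ refl])
  \<comment> \<open>The entry at \<open>i0\<close> is an arbitrary value; only the other entries are
    read off.\<close>
  then obtain y where y: "(\<chi> j. z (\<sigma> j)) = T y" by (rule surjE)
  show ?thesis
  proof (rule that)
    fix i
    assume "i \<in> {1..n}"
    then obtain k where "k \<noteq> i0" "i = \<sigma> k" using preimage by blast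
    then show "coeff (line_poly (F i) q y) 1 = z i"
      using fun_cong[OF arg_cong[OF y, of vec_nth], of k] by (simp add: T_def)
  qed
qed

section \<open>Symbolic powers of the ideal of a complete intersection\<close>

text \<open>Exponents are fixed to 0 outside S, so that each monomial has exactly one exponent
  function and, for finite S, there are finitely many.\<close>

definition multi_indices :: "'i set \<Rightarrow> nat \<Rightarrow> ('i \<Rightarrow> nat) set" where
  "multi_indices S m = {\<beta>. (\<forall>i. i \<notin> S \<longrightarrow> \<beta> i = 0) \<and> (\<Sum>i\<in>S. \<beta> i) = m}"

lemma finite_multi_indices:
  assumes "finite S"
  shows "finite (multi_indices S m)"
proof (rule finite_subset)
  show "multi_indices S m \<subseteq> {\<beta>. \<forall>i. (i \<in> S \<longrightarrow> \<beta> i \<in> {..m}) \<and> (i \<notin> S \<longrightarrow> \<beta> i = 0)}"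
    using assms by (auto simp: multi_indices_def intro!: member_le_sum)
  show "finite {\<beta>. \<forall>i. (i \<in> S \<longrightarrow> \<beta> i \<in> {..m}) \<and> (i \<notin> S \<longrightarrow> \<beta> i = 0)}"
    using assms by (intro finite_set_of_finite_funs) auto
qed

lemma inj_on_restrict_multi_indices: "inj_on (\<lambda>\<beta>. restrict \<beta> S) (multi_indices S m)"
proof (rule inj_onI, rule ext)
  fix \<beta> \<gamma> i
  assume "\<beta> \<in> multi_indices S m" "\<gamma> \<in> multi_indices S m" "restrict \<beta> S = restrict \<gamma> S"
  then show "\<beta> i = \<gamma> i"
    by (cases "i \<in> S") (auto simp: multi_indices_def dest: fun_cong[of _ _ i])
qed

lemma multi_indices_incr:
  assumes "finite S" "i \<in> S" "\<beta> \<in> multi_indices S m"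
  shows "\<beta>(i := Suc (\<beta> i)) \<in> multi_indices S (Suc m)"
  using assms by (auto simp: multi_indices_def sum.remove[of S i])

lemma prod_power_incr:
  fixes F :: "'i \<Rightarrow> 'a::comm_monoid_mult"
  assumes "finite S" "i \<in> S"
  shows "F i * (\<Prod>j\<in>S. F j ^ \<beta> j) = (\<Prod>j\<in>S. F j ^ (\<beta>(i := Suc (\<beta> i))) j)"
proof -
  have "(\<Prod>j\<in>S - {i}. F j ^ (\<beta>(i := Suc (\<beta> i))) j) = (\<Prod>j\<in>S - {i}. F j ^ \<beta> j)"
    by (rule prod.cong) auto
  then show ?thesis using assms by (simp add: prod.remove[of S i] mult.assoc)
qed

text \<open>The coefficients are indexed by \<open>B\<close> and not by the image, since different
  indices may give the same generator.\<close>

lemma ideal_span_image_explicit: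
  assumes "finite B" "f \<in> ideal.span (\<phi> ` B)"
  obtains g where "f = (\<Sum>b\<in>B. g b * \<phi> b)"
proof -
  have "\<exists>g. f = (\<Sum>b\<in>B. g b * \<phi> b)"
    using assms(2)
  proof (induction rule: ideal.span_induct_alt)
    case base
    show ?case by (rule exI[of _ "\<lambda>_. 0"]) simp
  next
    case (step c x y)
    then obtain g b where g: "y = (\<Sum>b\<in>B. g b * \<phi> b)" and b: "b \<in> B" "x = \<phi> b" by blast
    have "c * x = (\<Sum>b'\<in>B. (if b' = b then c * \<phi> b' else 0))"
      using b assms(1) by simp
    then have "c * x + y = (\<Sum>b'\<in>B. (g b' + (if b' = b then c else 0)) * \<phi> b')"
      by (simp add: g distrib_right sum.distrib if_distrib[of "\<lambda>a. a * _"] cong: if_cong)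
    then show ?case by (intro exI[of _ "\<lambda>b'. g b' + (if b' = b then c else 0)"])
  qed
  with that show ?thesis by blast
qed

text \<open>Membership in the symbolic power enters only through the orders of vanishing along
  lines. The induction keeps f and refines its expansion: the coefficients for m lie in the ideal,
  so every term gains one more factor \<open>F i\<close>.\<close>

lemma fat_ideal_subset_span:
  fixes X :: "('a::field_char_0 ^ 'v::finite) set set" and F :: "nat \<Rightarrow> ('a, 'v) polyring"
  assumes X: "X \<subseteq> proj_space" "finite X"
    and card: "CARD('v) = n + 1"
    and gen: "vanishing_ideal X = ideal.span (F ` {1..n})"
    and ord: "\<And>Q q y. Q \<in> X \<Longrightarrow> q \<in> Q \<Longrightarrow> q \<noteq> 0 \<Longrightarrow> [:0, 1:] ^ m dvd line_poly f q y"
  shows "f \<in> ideal.span ((\<lambda>\<beta>. \<Prod>i\<in>{1..n}. F i ^ \<beta> i) ` multi_indices {1..n} m)"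
  using ord
proof (induction m)
  case 0
  have "(\<lambda>_. 0) \<in> multi_indices {1..n} 0" by (simp add: multi_indices_def)
  then have "1 \<in> (\<lambda>\<beta>. \<Prod>i\<in>{1..n}. F i ^ \<beta> i) ` multi_indices {1..n} 0"
    by (rule rev_image_eqI) simp
  then have "f * 1 \<in> ideal.span ((\<lambda>\<beta>. \<Prod>i\<in>{1..n}. F i ^ \<beta> i) ` multi_indices {1..n} 0)"
    by (intro ideal.span_scale ideal.span_base)
  then show ?case by simp
next
  case (Suc m)
  let ?B = "multi_indices {1..n} m"
  let ?M = "\<lambda>\<beta>. \<Prod>i\<in>{1..n}. F i ^ \<beta> i"
  have "f \<in> ideal.span (?M ` ?B)"
    using Suc.prems by (intro Suc.IH) (meson dvd_trans le_SucI le_imp_power_dvd order_refl)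
  then obtain g where f: "f = (\<Sum>\<beta>\<in>?B. g \<beta> * ?M \<beta>)"
    by (rule ideal_span_image_explicit[OF finite_multi_indices, rotated]) auto
  have eval_g: "eval_poly (g \<beta>) q = 0" if Q: "Q \<in> X" and q: "q \<in> Q" "q \<noteq> 0" and \<beta>: "\<beta> \<in> ?B" for Q q \<beta>
  proof (rule monomial_sum_coeff_eq_0[where c = "\<lambda>\<beta>. eval_poly (g \<beta>) q" and S = "{1..n}" and B = ?B and e = id])
    fix z :: "nat \<Rightarrow> 'a"
    \<comment> \<open>Every z is the tuple of derivatives of the \<open>F i\<close> in some
      direction y, so vanishing for all y becomes vanishing for all z.\<close>
    obtain y where y: "\<And>i. i \<in> {1..n} \<Longrightarrow> coeff (line_poly (F i) q y) 1 = z i"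
      using differentials_surj[OF X Q q card gen] by metis
    have "\<exists>r. line_poly (F i) q y = [:0, 1:] * r \<and> poly r 0 = z i" if i: "i \<in> {1..n}" for i
    proof -
      have "F i \<in> vanishing_ideal X" unfolding gen using i by (intro ideal.span_base) auto
      then have "poly (line_poly (F i) q y) 0 = 0"
        using eval_poly_vanishing_ideal Q q by (simp add: poly_line_poly)
      then have "[:0, 1:] dvd line_poly (F i) q y" by (simp only: linear_dvd_iff)
      then obtain r where r: "line_poly (F i) q y = [:0, 1:] * r" by (rule dvdE)
      then have "poly r 0 = z i" using y[OF i] by (simp add: poly_0_coeff_0)
      with r show ?thesis by blast
    qed
    \<comment> \<open>\<open>r i\<close> is the restriction of \<open>F i\<close> divided by s; its
      value at 0 is the derivative z i.\<close>
    then obtain r where r: "\<And>i. i \<in> {1..n} \<Longrightarrow> line_poly (F i) q y = [:0, 1:] * r i"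
      "\<And>i. i \<in> {1..n} \<Longrightarrow> poly (r i) 0 = z i" by metis
    \<comment> \<open>The restriction of f divided by s^m. Its value at 0 is the sum to be shown
      zero, and order Suc m leaves it a factor s.\<close>
    let ?R = "\<Sum>\<beta>\<in>?B. line_poly (g \<beta>) q y * (\<Prod>i\<in>{1..n}. r i ^ \<beta> i)"
    have M: "line_poly (?M \<beta>) q y = [:0, 1:] ^ m * (\<Prod>i\<in>{1..n}. r i ^ \<beta> i)" if "\<beta> \<in> ?B" for \<beta>
    proof -
      have "line_poly (?M \<beta>) q y = (\<Prod>i\<in>{1..n}. [:0, 1:] ^ \<beta> i * r i ^ \<beta> i)"
        unfolding line_poly_prod line_poly_power
        by (rule prod.cong) (simp_all only: r power_mult_distrib)
      then show ?thesis
        using that by (simp only: prod.distrib multi_indices_def mem_Collect_eq flip: power_sum)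
    qed
    have "line_poly f q y = [:0, 1:] ^ m * ?R"
      unfolding f line_poly_sum line_poly_mult sum_distrib_left
      by (rule sum.cong) (simp_all only: M mult_ac)
    moreover have "[:0, 1:] ^ m * [:0, 1:] dvd line_poly f q y"
      using Suc.prems[OF Q q] by (simp only: power_Suc2)
    ultimately have "[:0, 1:] ^ m * [:0, 1:] dvd [:0, 1:] ^ m * ?R" by (simp only:)
    then have "[:0, 1:] dvd ?R" by (subst (asm) dvd_mult_cancel_left) auto
    then have "poly ?R 0 = 0" by (simp only: linear_dvd_iff)
    then show "(\<Sum>\<beta>\<in>?B. eval_poly (g \<beta>) q * (\<Prod>i\<in>{1..n}. z i ^ id \<beta> i)) = 0"
      by (simp add: poly_sum poly_prod r poly_line_poly)
  qed (use \<beta> finite_multi_indices inj_on_restrict_multi_indices in auto)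
  have "g \<beta> * ?M \<beta> \<in> ideal.span (?M ` multi_indices {1..n} (Suc m))" if \<beta>: "\<beta> \<in> ?B" for \<beta>
  proof -
    have "g \<beta> \<in> vanishing_ideal X" by (rule vanishing_idealI[OF X(1)]) (rule eval_g[OF _ _ _ \<beta>])
    then have "g \<beta> \<in> ideal.span (F ` {1..n})" unfolding gen .
    then show ?thesis
    proof (induction rule: ideal.span_induct_alt)
      case (step c x h)
      then obtain i where i: "i \<in> {1..n}" "x = F i" by blast
      have eq: "F i * ?M \<beta> = ?M (\<beta>(i := Suc (\<beta> i)))"
        using i(1) by (intro prod_power_incr) auto
      have "x * ?M \<beta> \<in> ideal.span (?M ` multi_indices {1..n} (Suc m))"
        unfolding i(2) eq
        by (intro ideal.span_base imageI multi_indices_incr[OF _ i(1) \<beta>]) simp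
      then have "c * (x * ?M \<beta>) + h * ?M \<beta> \<in> ideal.span (?M ` multi_indices {1..n} (Suc m))"
        using step.IH by (rule ideal.span_add[OF ideal.span_scale])
      then show ?case by (simp only: distrib_right mult.assoc)
    qed (simp add: ideal.span_zero)
  qed
  then show ?case unfolding f by (rule ideal.span_sum)
qed

text \<open>The generators F^\<beta> have degree \<Sum> \<beta>_i e_i, at least m a. Any lower bound
  a is allowed, so the lemma also fits the type of \<open>X1\<close>, whose lowered last entry may
  break monotonicity.\<close>

lemma degree_ge_of_mem_fat_ideal:
  fixes X :: "('a::field_char_0 ^ 'v::finite) set set"
  assumes CI: "complete_intersection n e X" and e: "\<And>i. i \<in> {1..n} \<Longrightarrow> a \<le> e i"
    and f: "f \<in> fat_ideal X m" "f \<in> forms t" "f \<noteq> 0"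
  shows "m * a \<le> t"
proof -
  obtain F :: "nat \<Rightarrow> ('a, 'v) polyring" where
    F: "\<And>i. i \<in> {1..n} \<Longrightarrow> F i \<in> forms (e i)" and gen: "vanishing_ideal X = ideal.span (F ` {1..n})"
    using CI unfolding complete_intersection_def by blast
  have X: "X \<subseteq> proj_space" "finite X" "CARD('v) = n + 1"
    using CI unfolding complete_intersection_def by blast+
  have "f \<in> ideal.span ((\<lambda>\<beta>. \<Prod>i\<in>{1..n}. F i ^ \<beta> i) ` multi_indices {1..n} m)"
    by (rule fat_ideal_subset_span[OF X gen], rule dvd_line_poly_ideal_power)
      (use f(1) in \<open>auto simp: fat_ideal_def\<close>)
  moreover have "ideal.span ((\<lambda>\<beta>. \<Prod>i\<in>{1..n}. F i ^ \<beta> i) ` multi_indices {1..n} m)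
      \<subseteq> {f. \<forall>u\<in>Poly_Mapping.keys f. m * a \<le> monom_degree u}"
  proof (rule ideal.span_minimal[OF _ subspace_low_degree_zero], safe)
    fix \<beta> u
    assume \<beta>: "\<beta> \<in> multi_indices {1..n} m" and u: "u \<in> Poly_Mapping.keys (\<Prod>i\<in>{1..n}. F i ^ \<beta> i)"
    have "(\<Prod>i\<in>{1..n}. F i ^ \<beta> i) \<in> forms (\<Sum>i\<in>{1..n}. \<beta> i * e i)"
      by (intro forms_prod forms_power F)
    then have "monom_degree u = (\<Sum>i\<in>{1..n}. \<beta> i * e i)" using u by (simp add: forms_def)
    also have "\<dots> \<ge> (\<Sum>i\<in>{1..n}. \<beta> i * a)" by (intro sum_mono mult_left_mono e) auto
    also have "(\<Sum>i\<in>{1..n}. \<beta> i * a) = m * a"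
      using \<beta> by (simp add: multi_indices_def flip: sum_distrib_right)
    finally show "m * a \<le> monom_degree u" .
  qed
  moreover obtain u where "u \<in> Poly_Mapping.keys f" using f(3) by fastforce
  ultimately have "m * a \<le> monom_degree u" by blast
  then show ?thesis using f(2) \<open>u \<in> Poly_Mapping.keys f\<close> by (simp add: forms_def)
qed

section \<open>Initial degrees and the bounds of the theorem\<close>

lemma fat_ideal_antimono: "A \<subseteq> B \<Longrightarrow> fat_ideal B m \<subseteq> fat_ideal A m"
  unfolding fat_ideal_def by blast

lemma zero_mem_ideal_power: "0 \<in> ideal_power I m"
  by (cases m) (auto intro: ideal.span_zero)

lemma alpha_le: "f \<in> I \<Longrightarrow> f \<in> forms k \<Longrightarrow> f \<noteq> 0 \<Longrightarrow> alpha I \<le> k"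
  unfolding alpha_def by (rule Least_le) auto

text \<open>The hypothesis 0 \<in> I rules out an empty intersection, which would also differ from
  {0}.\<close>

lemma alpha_attained:
  assumes "0 \<in> I" "f \<in> I" "f \<in> forms k" "f \<noteq> 0"
  obtains g where "g \<in> I" "g \<in> forms (alpha I)" "g \<noteq> 0"
proof -
  have "I \<inter> forms (alpha I) \<noteq> {0}"
    unfolding alpha_def by (rule LeastI[of _ k]) (use assms in auto)
  then show ?thesis using that assms(1) by auto
qed

theorem theorem5p6:
  fixes X X1 X2 :: "('a::{alg_closed_field, field_char_0} ^ 'v::finite) set set"
    and d :: "nat \<Rightarrow> nat" and n m :: nat and P :: "('a ^ 'v) set"
  assumes "n \<ge> 1" and "CARD('v) = n + 1"
    and "complete_intersection n d X"
    and "mono_on {1..n} d"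
    and "CI_splits n d n X X1 X2"
    and "m \<ge> 1"
    and "P \<in> X2"
  defines "Z \<equiv> fat_ideal X m"
    and "Y \<equiv> fat_ideal (X - {P}) m"
  shows "(d 1 = d n \<longrightarrow>
            m * (d 1 - 1) \<le> alpha Y \<and> alpha Y \<le> alpha Z \<and> alpha Z = m * d 1) \<and>
         (d 1 < d n \<longrightarrow> alpha Y = m * d 1 \<and> alpha Z = m * d 1)"
proof -
  obtain F :: "nat \<Rightarrow> ('a, 'v) polyring" where
    F: "F 1 \<in> forms (d 1)" "F 1 \<noteq> 0" "vanishing_ideal X = ideal.span (F ` {1..n})"
    using assms(1,3) unfolding complete_intersection_def by fastforce
  \<comment> \<open>\<open>F 1\<close> has the least degree among the generators; its m-th power
    gives the upper bounds.\<close>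
  have "F 1 \<in> vanishing_ideal X" unfolding F(3) using assms(1) by (intro ideal.span_base) auto
  then have FZ: "F 1 ^ m \<in> Z" unfolding Z_def by (rule power_mem_fat_ideal)
  have Fm: "F 1 ^ m \<in> forms (m * d 1)" by (rule forms_power) (rule F)
  \<comment> \<open>A nonzero polynomial is nonzero at some point, and so is its power
    there.\<close>
  have Fnz: "F 1 ^ m \<noteq> 0"
  proof
    assume "F 1 ^ m = 0"
    then have "eval_poly (F 1) x ^ m = 0" for x by (simp flip: eval_poly_power)
    then show False using poly_eq_0_if_eval_poly_eq_0[of "F 1"] F(2) by simp
  qed
  have d1: "d 1 \<le> d i" if "i \<in> {1..n}" for i
    using assms(4) that by (auto simp: mono_on_def)
  have X1: "complete_intersection n (d(n := d n - 1)) X1" and sub: "X1 \<subseteq> X - {P}"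
    using assms(5,7) unfolding CI_splits_def by auto
  have ZY: "Z \<subseteq> Y" unfolding Z_def Y_def by (rule fat_ideal_antimono) auto
  have zero: "0 \<in> fat_ideal W m" for W :: "('a ^ 'v) set set"
    by (simp add: fat_ideal_def zero_mem_ideal_power)
  obtain g where g: "g \<in> Z" "g \<in> forms (alpha Z)" "g \<noteq> 0"
    by (rule alpha_attained[OF _ FZ Fm Fnz]) (simp add: Z_def zero)
  obtain h where h: "h \<in> Y" "h \<in> forms (alpha Y)" "h \<noteq> 0"
    by (rule alpha_attained[OF _ subsetD[OF ZY FZ] Fm Fnz]) (simp add: Y_def zero)
  have Z: "alpha Z \<le> m * d 1" using FZ Fm Fnz by (rule alpha_le)
  have Z': "m * d 1 \<le> alpha Z"
    using degree_ge_of_mem_fat_ideal[OF assms(3) d1 g(1)[unfolded Z_def] g(2,3)] .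
  have YZ: "alpha Y \<le> alpha Z" using g ZY by (intro alpha_le) auto
  \<comment> \<open>The bound comes from the complete intersection \<open>X1\<close>, whose fat
    ideal contains \<open>Y\<close>; its smallest degree is the minimum of \<open>d 1\<close> and
    \<open>d n - 1\<close> or larger.\<close>
  have Y: "m * a \<le> alpha Y" if "a \<le> d 1" "a \<le> d n - 1" for a
  proof (rule degree_ge_of_mem_fat_ideal[OF X1 _ _ h(2,3)])
    show "h \<in> fat_ideal X1 m" using h(1) fat_ideal_antimono[OF sub] unfolding Y_def by blast
    show "a \<le> (d(n := d n - 1)) i" if "i \<in> {1..n}" for i
      using d1[OF that] \<open>a \<le> d 1\<close> \<open>a \<le> d n - 1\<close> by auto
  qed
  \<comment> \<open>The value \<open>d 1 - 1\<close> settles equal degrees; \<open>d 1\<close> is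
    admissible exactly when \<open>d 1 \<le> d n - 1\<close>, which is case (ii).\<close>
  show ?thesis using Z Z' YZ Y[of "d 1 - 1"] Y[of "d 1"] by auto
qed

end
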